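(* Let $N \ge 6$ be an integer and suppose the hyperbola $xy = N$ has three distinct lattice points $(x_1, y_1)$, $(x_2, y_2)$, $(x_3, y_3)$ with positive integer coordinates. Then $$\max_{1 \le i \le 3} |x_i - y_i| \ge \left\lfloor 2 N^{1/4} + \frac{1}{2 N^{1/4} - 1} \right\rfloor .$$ Moreover, the lower bound is best possible: there are infinitely many integers $N \ge 6$ for which there exist three distinct lattice points $(x_i, y_i)$ ($i = 1,2,3$) with positive integer coordinates on $xy = N$ such that $$\max_{1 \le i \le 3} |x_i - y_i| = \left\lfloor 2 N^{1/4} + \frac{1}{2 N^{1/4} - 1} \right\rfloor .$$
   Context: Here $\lfloor x \rfloor$ denotes the largest integer not exceeding $x$. *)

theory Defs
  imports Complex_Main
begin

(* The points are (x i, y i) for i = 1, 2, 3; values of x and y at other indices are irrelevant.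
   Points are ordered pairs, so (a, b) and (b, a) are distinct when a \<noteq> b. *)
definition three_lattice_points :: "int \<Rightarrow> (nat \<Rightarrow> int) \<Rightarrow> (nat \<Rightarrow> int) \<Rightarrow> bool" where
  "three_lattice_points N x y \<longleftrightarrow>
     (\<forall>i\<in>{1..3}. x i > 0 \<and> y i > 0 \<and> x i * y i = N) \<and>
     inj_on (\<lambda>i. (x i, y i)) {1..3}"

definition hyperbola_bound :: "int \<Rightarrow> int" where
  "hyperbola_bound N =
     \<lfloor>2 * real_of_int N powr (1/4) + 1 / (2 * real_of_int N powr (1/4) - 1)\<rfloor>"

end

theory Submission
  imports Defs
begin

text \<open>
  Put \<open>t = 2 N powr (1/4)\<close>. A point on \<open>xy = N\<close> is determined up to order by \<open>x + y \<ge> 2 \<surd>N\<close>, so among three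
  points two have different sums, and the larger sum is at least \<open>2 \<surd>N + 1\<close>. For that point
  \<open>(x - y)\<^sup>2 = (x + y)\<^sup>2 - 4N \<ge> 4 \<surd>N + 1 > t\<^sup>2\<close>, and \<open>\<bar>x - y\<bar> > t\<close> suffices since \<open>1 / (t - 1) \<le> 1\<close>.
  For \<open>N = (k(k + 1))\<^sup>2\<close> the points \<open>(k\<^sup>2, (k + 1)\<^sup>2)\<close>, its mirror image and \<open>(k(k + 1), k(k + 1))\<close>
  have maximal difference \<open>2k + 1 = \<surd>(t\<^sup>2 + 1)\<close>, which attains the bound.
\<close>

lemma fourth_root_double_square:
  fixes n :: real
  assumes "n \<ge> 0"
  shows "(2 * n powr (1/4))\<^sup>2 = 4 * sqrt n"
proof -
  have "(n powr (1/4))\<^sup>2 = n powr (1/4) * n powr (1/4)"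
    by (simp add: power2_eq_square)
  also have "\<dots> = n powr (1/2)"
    by (simp flip: powr_add)
  finally show ?thesis
    using assms by (simp add: powr_half_sqrt power_mult_distrib)
qed

lemma fourth_root_double_ge_2:
  fixes n :: real
  assumes "n \<ge> 1"
  shows "2 * n powr (1/4) \<ge> 2"
  using assms by (simp add: ge_one_powr_ge_zero)

text \<open>By Vieta, \<open>a\<close> is a root of the monic quadratic with roots \<open>c\<close>
  and \<open>d\<close>, and the sum then fixes \<open>b\<close>.\<close>

lemma sum_and_product_eq_imp:
  fixes a b c d :: int
  assumes "a + b = c + d" "a * b = c * d"
  shows "(a, b) = (c, d) \<or> (a, b) = (d, c)"
proof -
  have "b = c + d - a" using assms(1) by simp
  with assms(2) have "(a - c) * (a - d) = 0" by (simp add: algebra_simps)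
  then show ?thesis using assms(1) by auto
qed

lemma difference_bound_of_larger_sum:
  fixes a b c d N :: int
  assumes pos: "a > 0" "b > 0" "c > 0" "d > 0"
    and prod: "a * b = N" "c * d = N" and less: "c + d < a + b"
  shows "hyperbola_bound N \<le> \<bar>a - b\<bar>"
proof -
  define t where "t = 2 * real_of_int N powr (1/4)"
  define s where "s = sqrt (real_of_int N)"
  have N: "N \<ge> 1" using pos prod using mult_pos_pos[OF pos(1,2)] by simp
  have t2: "t\<^sup>2 = 4 * s" unfolding t_def s_def using N by (intro fourth_root_double_square) simp
  have tge: "t \<ge> 2" unfolding t_def using N by (intro fourth_root_double_ge_2) simp
  have s: "s \<ge> 0" "s\<^sup>2 = real_of_int N" unfolding s_def using N by simp_all
  \<comment> \<open>AM-GM for the point with the smaller sum, in squared form so that it reduces to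
    the integer fact that \<open>(c - d)\<^sup>2\<close> is nonnegative.\<close>
  have "(2 * s)\<^sup>2 \<le> (real_of_int (c + d))\<^sup>2"
  proof -
    have "4 * N \<le> (c + d)\<^sup>2"
      using prod(2) zero_le_power2[of "c - d"] by (simp add: power2_eq_square algebra_simps)
    then have "real_of_int (4 * N) \<le> real_of_int ((c + d)\<^sup>2)"
      by (simp only: of_int_le_iff)
    then show ?thesis using s by (simp add: power_mult_distrib)
  qed
  then have "2 * s \<le> real_of_int (c + d)"
    by (rule power2_le_imp_le) (use pos in simp)
  \<comment> \<open>Integrality turns the strict inequality of sums into a gap of 1; this is the
    source of the extra \<open>+ 1\<close> beyond \<open>4 * s\<close>.\<close>
  also have "\<dots> \<le> real_of_int (a + b) - 1" using less by linarith
  finally have "(2 * s + 1)\<^sup>2 \<le> (real_of_int (a + b))\<^sup>2"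
    using s by (intro power_mono) auto
  moreover have "(real_of_int (a + b))\<^sup>2 = (real_of_int (a - b))\<^sup>2 + 4 * real_of_int N"
    unfolding prod(1)[symmetric] by (simp add: power2_eq_square algebra_simps)
  ultimately have "t\<^sup>2 < \<bar>real_of_int (a - b)\<bar>\<^sup>2"
    using s t2 by (simp add: power2_eq_square algebra_simps)
  then have "t < \<bar>real_of_int (a - b)\<bar>" by (rule power2_less_imp_less) simp
  moreover have "1 / (t - 1) \<le> 1" using tge by simp
  \<comment> \<open>A floor is at most an integer \<open>n\<close> exactly when its argument is
    below \<open>n + 1\<close>, so the correction term may use up a full unit.\<close>
  ultimately have "t + 1 / (t - 1) < real_of_int (\<bar>a - b\<bar> + 1)" by simp
  then show ?thesis
    unfolding hyperbola_bound_def t_def[symmetric] by (simp add: floor_less_iff floor_le_iff)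
qed

lemma three_lattice_points_bound:
  assumes "three_lattice_points N x y"
  shows "hyperbola_bound N \<le> (MAX i\<in>{1..3}. \<bar>x i - y i\<bar>)"
proof -
  have pts: "x i > 0" "y i > 0" "x i * y i = N" if "i \<in> {1..3}" for i
    using assms that unfolding three_lattice_points_def by auto
  have inj: "inj_on (\<lambda>i. (x i, y i)) {1..3}"
    using assms unfolding three_lattice_points_def by simp
  have "\<exists>i\<in>{1..3}. \<exists>j\<in>{1..3}. x j + y j < x i + y i"
  proof (rule ccontr)
    assume "\<not> ?thesis"
    then have sums: "x i + y i = x j + y j" if "i \<in> {1..3}" "j \<in> {1..3}" for i j
      using that by (meson linorder_neqE)
    then have swap: "(x i, y i) = (x j, y j) \<or> (x i, y i) = (y j, x j)"
      if "i \<in> {1..3}" "j \<in> {1..3}" for i j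
      using sum_and_product_eq_imp[OF sums[OF that]] pts(3) that by simp
    have ne: "(x i, y i) \<noteq> (x j, y j)" if "i \<in> {1..3}" "j \<in> {1..3}" "i \<noteq> j" for i j
      using inj that by (meson inj_onD)
    \<comment> \<open>Points 2 and 3 both differ from point 1, so each would be its mirror image,
      and they would coincide.\<close>
    show False
      using swap[of 2 1] swap[of 3 1] ne[of 2 1] ne[of 3 1] ne[of 2 3] by auto
  qed
  then obtain i j where ij: "i \<in> {1..3}" "j \<in> {1..3}" "x j + y j < x i + y i" by blast
  then have "hyperbola_bound N \<le> \<bar>x i - y i\<bar>"
    using pts by (intro difference_bound_of_larger_sum[of _ _ "x j" "y j"]) auto
  also have "\<dots> \<le> (MAX i\<in>{1..3}. \<bar>x i - y i\<bar>)"
    using ij(1) by (intro Max_ge) auto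
  finally show ?thesis .
qed

text \<open>With \<open>m = 2 * k + 1\<close> one has \<open>m\<^sup>2 - t\<^sup>2 = 1\<close>, so
  \<open>m\<close> exceeds \<open>t\<close> by \<open>1 / (m + t)\<close>, which the correction term
  \<open>1 / (t - 1)\<close> covers.\<close>

lemma hyperbola_bound_square_pronic_ge:
  fixes k :: int
  assumes "k \<ge> 1"
  shows "2 * k + 1 \<le> hyperbola_bound ((k * (k + 1))\<^sup>2)"
proof -
  define N where "N = (k * (k + 1))\<^sup>2"
  define t where "t = 2 * real_of_int N powr (1/4)"
  define m where "m = real_of_int (2 * k + 1)"
  have "k * (k + 1) \<ge> 1" using assms by (simp add: int_one_le_iff_zero_less)
  then have N: "N \<ge> 1"
    unfolding N_def by (rule one_le_power)
  have sqrtN: "sqrt (real_of_int N) = real_of_int (k * (k + 1))"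
    unfolding N_def of_int_power using assms by (intro real_sqrt_unique) auto
  have tge: "t \<ge> 2" unfolding t_def using N by (intro fourth_root_double_ge_2) simp
  have "t\<^sup>2 = 4 * sqrt (real_of_int N)"
    unfolding t_def using N by (intro fourth_root_double_square) simp
  also have "\<dots> = m\<^sup>2 - 1"
    unfolding sqrtN m_def by (simp add: power2_eq_square algebra_simps)
  finally have "(m - t) * (m + t) = 1"
    by (simp add: power2_eq_square algebra_simps)
  moreover have mpos: "m > 0" using assms by (simp add: m_def)
  ultimately have "m - t = 1 / (m + t)" using tge by (simp add: field_simps)
  also have "\<dots> \<le> 1 / (t - 1)" using tge mpos by (intro divide_left_mono mult_pos_pos) auto
  finally have "real_of_int (2 * k + 1) \<le> t + 1 / (t - 1)"
    unfolding m_def by linarith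
  then show ?thesis
    unfolding hyperbola_bound_def N_def[symmetric] t_def[symmetric] by (simp only: le_floor_iff)
qed

lemma square_pronic_attains_bound:
  fixes k :: int
  assumes "k \<ge> 1"
  defines "N \<equiv> (k * (k + 1))\<^sup>2"
  shows "\<exists>x y. three_lattice_points N x y \<and>
           (MAX i\<in>{1..3}. \<bar>x i - y i\<bar>) = hyperbola_bound N"
proof -
  have range: "{1..3} = {1, 2, 3 :: nat}" by auto
  define x :: "nat \<Rightarrow> int" where
    "x i = (if i = 1 then k\<^sup>2 else if i = 2 then (k + 1)\<^sup>2 else k * (k + 1))" for i
  define y :: "nat \<Rightarrow> int" where
    "y i = (if i = 1 then (k + 1)\<^sup>2 else if i = 2 then k\<^sup>2 else k * (k + 1))" for i
  have less: "k\<^sup>2 < k * (k + 1)" "k * (k + 1) < (k + 1)\<^sup>2"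
    using assms(1) by (simp_all add: power2_eq_square algebra_simps)
  have pts: "three_lattice_points N x y"
    unfolding three_lattice_points_def
  proof
    show "\<forall>i\<in>{1..3}. x i > 0 \<and> y i > 0 \<and> x i * y i = N"
      unfolding range N_def x_def y_def
      using assms(1) by (auto simp: power_mult_distrib power2_eq_square)
    show "inj_on (\<lambda>i. (x i, y i)) {1..3}"
      unfolding range x_def y_def using less less_trans[OF less] by auto
  qed
  \<comment> \<open>Equality comes from a sandwich: the maximum is at most \<open>2 * k + 1\<close>,
    hence at most the bound, and the general lower bound applied to these points gives the
    converse.\<close>
  have "(MAX i\<in>{1..3}. \<bar>x i - y i\<bar>) \<le> 2 * k + 1"
    using assms(1) unfolding range x_def y_def by (simp add: power2_eq_square algebra_simps)
  also have "\<dots> \<le> hyperbola_bound N"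
    unfolding N_def using assms(1) by (rule hyperbola_bound_square_pronic_ge)
  finally have "(MAX i\<in>{1..3}. \<bar>x i - y i\<bar>) = hyperbola_bound N"
    using three_lattice_points_bound[OF pts] by (rule antisym)
  with pts show ?thesis by blast
qed

theorem theorem4:
  shows "(\<forall>(N::int) x y. N \<ge> 6 \<longrightarrow> three_lattice_points N x y \<longrightarrow>
            (MAX i\<in>{1..3}. \<bar>x i - y i\<bar>) \<ge> hyperbola_bound N) \<and>
         infinite {N::int. N \<ge> 6 \<and> (\<exists>x y. three_lattice_points N x y \<and>
            (MAX i\<in>{1..3}. \<bar>x i - y i\<bar>) = hyperbola_bound N)}"
    (is "_ \<and> infinite ?A")
proof
  show "\<forall>(N::int) x y. N \<ge> 6 \<longrightarrow> three_lattice_points N x y \<longrightarrow>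
          (MAX i\<in>{1..3}. \<bar>x i - y i\<bar>) \<ge> hyperbola_bound N"
    using three_lattice_points_bound by blast
  define f where "f k = (k * (k + 1))\<^sup>2" for k :: int
  have mono: "f k < f l" if "2 \<le> k" "k < l" for k l
    unfolding f_def using that by (intro power_strict_mono mult_strict_mono) auto
  \<comment> \<open>The family starts at \<open>k = 2\<close>, where \<open>f 2 = 36\<close>,
    because \<open>f 1 = 4\<close> violates \<open>N \<ge> 6\<close>.\<close>
  have "inj_on f {2..}"
    by (intro linorder_inj_onI') (use mono in fastforce)
  moreover have "infinite {2 :: int..}" by (rule infinite_Ici)
  ultimately have "infinite (f ` {2..})" by (simp add: finite_image_iff)
  moreover have "f ` {2..} \<subseteq> ?A"
  proof
    fix N assume "N \<in> f ` {2..}"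
    then obtain k where k: "k \<ge> 2" "N = f k" by auto
    have "f 2 \<le> f k" using mono[of 2 k] k(1) by (cases "k = 2") auto
    then have "N \<ge> 6" using k(2) by (simp add: f_def)
    moreover have "\<exists>x y. three_lattice_points N x y \<and>
        (MAX i\<in>{1..3}. \<bar>x i - y i\<bar>) = hyperbola_bound N"
      using square_pronic_attains_bound[of k] k by (simp add: f_def)
    ultimately show "N \<in> ?A" by blast
  qed
  ultimately show "infinite ?A" using finite_subset by blast
qed

end
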